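(* Let $(M,\tau)$ be a noncommutative, faithful, tracial probability space. Let $(x_i)_{i\in\mathbb{N}}$ be a sequence of free, non-zero, identically distributed, noncommutative random variables in $M$, and let $s_n:=x_1+\cdots+x_n$. Then for any $m\le n$, $$R(s_n,s_m)=\sqrt{\frac{m}{n}}.$$
   Context: A noncommutative, faithful, tracial probability space $(M,\tau)$ is a unital $*$-algebra $M$ equipped with a $*$-linear form $\tau:M\to\mathbb{C}$ (linear, with $\tau(x^* )=\overline{\tau(x)}$) such that $\tau(1)=1$ and, for all $x,y\in M$, $\tau(xy)=\tau(yx)$, $\tau(x^*x)\ge 0$, and $\tau(x^*x)=0$ if and only if $x=0$. Elements of $M$ are called noncommutative random variables. The distribution of $(x_1,\ldots,x_n)\in M^n$ is the family of moments $(\tau(x_{i_1}\cdots x_{i_r}) : r\ge 1,\ 1\le i_1,\ldots,i_r\le n)$; variables are identically distributed if they have the same distribution. Unital sub-algebras $M_1,M_2,\ldots\subseteq M$ are free if $\tau(a_1\cdots a_r)=0$ whenever $\tau(a_j)=0$ for all $1\le j\le r$ and $a_j\in M_{i_j}$ with $i_1\ne i_2,\ i_2\ne i_3,\ldots,\ i_{r-1}\ne i_r$. Noncommutative random variables are free if the respective unital sub-$*$-algebras they span are free. $L^2(M)$ is the Hilbert space completion of $M$ for the inner product $\langle x,y\rangle:=\tau(x^*y)$, with norm $\|x\|_2:=\sqrt{\langle x,x\rangle}$; $\tau$ extends to $L^2(M)$ by $\tau(x)=\langle 1,x\rangle$. For $x\in M$, $L^2(x)$ is the closure in $L^2(M)$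 of the sub-$*$-algebra $\mathbb{C}\langle x\rangle$ of noncommutative polynomials in $x$ and $x^*$. Set $\operatorname{cov}(x,y):=\langle x-\tau(x)\cdot 1,\ y-\tau(y)\cdot 1\rangle$, $\sigma(x)^2:=\operatorname{cov}(x,x)$ with $\sigma(x)\ge 0$, and $\rho(x,y):=\operatorname{cov}(x,y)/(\sigma(x)\sigma(y))$. The maximal correlation coefficient of two subspaces $M_1,M_2$ is $R(M_1,M_2):=\sup_{M_1\times M_2}\rho$, and for noncommutative random variables $x,y$ one writes $R(x,y):=R(L^2(x),L^2(y))$.
   Formalization: "Identically distributed" is taken to mean equal joint moments of x and x* (equal moments of x alone do not suffice if x is not self-adjoint), and "non-zero" is replaced by "not a scalar multiple of 1", since otherwise every σ vanishes and R is undefined. *)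

theory Defs
  imports "HOL-Analysis.Analysis"
begin

locale tracial_prob_space = vector_space scale
  for scale :: "complex \<Rightarrow> 'a::ring_1 \<Rightarrow> 'a" (infixr \<open>*\<^sub>C\<close> 75) +
  fixes star :: "'a \<Rightarrow> 'a"
    and tau :: "'a \<Rightarrow> complex"
  assumes scale_mult_left: "(c *\<^sub>C x) * y = c *\<^sub>C (x * y)"
    and scale_mult_right: "x * (c *\<^sub>C y) = c *\<^sub>C (x * y)"
    and star_add: "star (x + y) = star x + star y"
    and star_scale: "star (c *\<^sub>C x) = cnj c *\<^sub>C star x"
    and star_mult: "star (x * y) = star y * star x"
    and star_star: "star (star x) = x"
    and tau_add: "tau (x + y) = tau x + tau y"
    and tau_scale: "tau (c *\<^sub>C x) = c * tau x"
    and tau_star: "tau (star x) = cnj (tau x)"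
    and tau_one: "tau 1 = 1"
    and tau_commute: "tau (x * y) = tau (y * x)"
    and tau_nonneg: "tau (star x * x) \<in> \<real>\<^sub>\<ge>\<^sub>0"
    and tau_faithful: "tau (star x * x) = 0 \<longleftrightarrow> x = 0"
begin

subsection \<open>Distributions and freeness\<close>

definition same_distribution :: "'a list \<Rightarrow> 'a list \<Rightarrow> bool" where
  "same_distribution xs ys \<longleftrightarrow> length xs = length ys \<and>
     (\<forall>w. w \<noteq> [] \<and> set w \<subseteq> {..<length xs} \<longrightarrow>
        tau (prod_list (map (\<lambda>i. xs ! i) w)) = tau (prod_list (map (\<lambda>i. ys ! i) w)))"

text \<open>
  Variables need not be self-adjoint, so the distribution of a single variable \<open>x\<close> is that of
  the pair \<open>(x, x\<^sup>*)\<close>. For self-adjoint \<open>x\<close> this amounts to the sequence of moments of \<open>x\<close>.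
\<close>

definition identically_distributed :: "'a \<Rightarrow> 'a \<Rightarrow> bool" where
  "identically_distributed x y \<longleftrightarrow> same_distribution [x, star x] [y, star y]"

definition star_polys :: "'a \<Rightarrow> 'a set" where
  "star_polys x = span {prod_list w | w. set w \<subseteq> {x, star x}}"

definition free_subalgebras :: "('i \<Rightarrow> 'a set) \<Rightarrow> bool" where
  "free_subalgebras M \<longleftrightarrow>
     (\<forall>is as. as \<noteq> [] \<and> length is = length as \<and> distinct_adj is \<and>
        (\<forall>j<length as. as ! j \<in> M (is ! j) \<and> tau (as ! j) = 0) \<longrightarrow> tau (prod_list as) = 0)"

definition free_variables :: "('i \<Rightarrow> 'a) \<Rightarrow> bool" where
  "free_variables x \<longleftrightarrow> free_subalgebras (\<lambda>i. star_polys (x i))"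

subsection \<open>The completion \<open>L\<^sup>2(M)\<close>\<close>

text \<open>
  The completion is the set of Cauchy sequences of \<open>M\<close> modulo null sequences. Its operations are
  given on representatives; lemmas below show that they do not depend on the choice.
\<close>

definition l2_norm :: "'a \<Rightarrow> real" where
  "l2_norm x = sqrt (Re (tau (star x * x)))"

definition l2_Cauchy :: "(nat \<Rightarrow> 'a) \<Rightarrow> bool" where
  "l2_Cauchy X \<longleftrightarrow> (\<forall>e>0. \<exists>N. \<forall>j\<ge>N. \<forall>k\<ge>N. l2_norm (X j - X k) < e)"

definition L2_rel :: "((nat \<Rightarrow> 'a) \<times> (nat \<Rightarrow> 'a)) set" where
  "L2_rel = {(X, Y). l2_Cauchy X \<and> l2_Cauchy Y \<and> (\<lambda>k. l2_norm (X k - Y k)) \<longlonglongrightarrow> 0}"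

definition L2 :: "(nat \<Rightarrow> 'a) set set" where
  "L2 = {X. l2_Cauchy X} // L2_rel"

definition L2_emb :: "'a \<Rightarrow> (nat \<Rightarrow> 'a) set" where
  "L2_emb a = L2_rel `` {\<lambda>_. a}"

definition L2_minus :: "(nat \<Rightarrow> 'a) set \<Rightarrow> (nat \<Rightarrow> 'a) set \<Rightarrow> (nat \<Rightarrow> 'a) set" where
  "L2_minus \<xi> \<eta> = (\<Union>X\<in>\<xi>. \<Union>Y\<in>\<eta>. L2_rel `` {\<lambda>k. X k - Y k})"

definition L2_inner :: "(nat \<Rightarrow> 'a) set \<Rightarrow> (nat \<Rightarrow> 'a) set \<Rightarrow> complex" where
  "L2_inner \<xi> \<eta> = the_elem (\<Union>X\<in>\<xi>. \<Union>Y\<in>\<eta>. {lim (\<lambda>k. tau (star (X k) * Y k))})"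

definition L2_norm :: "(nat \<Rightarrow> 'a) set \<Rightarrow> real" where
  "L2_norm \<xi> = sqrt (Re (L2_inner \<xi> \<xi>))"

definition L2_tau :: "(nat \<Rightarrow> 'a) set \<Rightarrow> complex" where
  "L2_tau \<xi> = L2_inner (L2_emb 1) \<xi>"

definition L2_closure :: "(nat \<Rightarrow> 'a) set set \<Rightarrow> (nat \<Rightarrow> 'a) set set" where
  "L2_closure A = {\<xi> \<in> L2. \<forall>e>0. \<exists>\<eta>\<in>A. L2_norm (L2_minus \<xi> \<eta>) < e}"

definition L2_of :: "'a \<Rightarrow> (nat \<Rightarrow> 'a) set set" where
  "L2_of x = L2_closure (L2_emb ` star_polys x)"

subsection \<open>Maximal correlation\<close>

definition centered :: "(nat \<Rightarrow> 'a) set \<Rightarrow> (nat \<Rightarrow> 'a) set" where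
  "centered \<xi> = L2_minus \<xi> (L2_emb (L2_tau \<xi> *\<^sub>C 1))"

definition cov :: "(nat \<Rightarrow> 'a) set \<Rightarrow> (nat \<Rightarrow> 'a) set \<Rightarrow> complex" where
  "cov \<xi> \<eta> = L2_inner (centered \<xi>) (centered \<eta>)"

definition sigma :: "(nat \<Rightarrow> 'a) set \<Rightarrow> real" where
  "sigma \<xi> = sqrt (Re (cov \<xi> \<xi>))"

definition rho :: "(nat \<Rightarrow> 'a) set \<Rightarrow> (nat \<Rightarrow> 'a) set \<Rightarrow> complex" where
  "rho \<xi> \<eta> = cov \<xi> \<eta> / complex_of_real (sigma \<xi> * sigma \<eta>)"

text \<open>
  The supremum runs over the pairs for which \<open>\<rho>\<close> is defined. As \<open>\<rho>\<close> is complex-valued, its real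
  part is taken; on complex subspaces this gives the same supremum as the modulus, since one of
  the two arguments can be multiplied by a phase.
\<close>

definition max_corr_subspaces ::
    "(nat \<Rightarrow> 'a) set set \<Rightarrow> (nat \<Rightarrow> 'a) set set \<Rightarrow> real" where
  "max_corr_subspaces M1 M2 =
     Sup {Re (rho \<xi> \<eta>) | \<xi> \<eta>. \<xi> \<in> M1 \<and> \<eta> \<in> M2 \<and> sigma \<xi> \<noteq> 0 \<and> sigma \<eta> \<noteq> 0}"

definition max_corr :: "'a \<Rightarrow> 'a \<Rightarrow> real" where
  "max_corr x y = max_corr_subspaces (L2_of x) (L2_of y)"

subsection \<open>Well-definedness\<close>

lemma tau_zero: "tau 0 = 0"
  using tau_add[of 0 0] by simp

lemma tau_minus: "tau (- x) = - tau x"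
  using tau_add[of x "- x"] tau_zero by (simp add: eq_neg_iff_add_eq_0 add.commute)

lemma tau_diff: "tau (x - y) = tau x - tau y"
  using tau_add[of x "- y"] by (simp add: tau_minus)

lemma star_zero: "star 0 = 0"
  using star_add[of 0 0] by simp

lemma star_minus: "star (- x) = - star x"
  using star_add[of x "- x"] star_zero by (simp add: eq_neg_iff_add_eq_0 add.commute)

lemma star_diff: "star (x - y) = star x - star y"
  using star_add[of x "- y"] by (simp add: star_minus)

lemma tau_inner_commute: "tau (star y * x) = cnj (tau (star x * y))"
  using tau_star[of "star x * y"] by (simp add: star_mult star_star)

lemma tau_square: "tau (star x * x) = complex_of_real ((l2_norm x)\<^sup>2)"
proof -
  obtain r where "tau (star x * x) = complex_of_real r" "r \<ge> 0"
    using tau_nonneg[of x] by (auto simp: nonneg_Reals_def)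
  then show ?thesis by (simp add: l2_norm_def)
qed

lemma l2_norm_nonneg: "0 \<le> l2_norm x"
proof -
  have "0 \<le> Re (tau (star x * x))" using tau_nonneg[of x] by (auto simp: nonneg_Reals_def)
  then show ?thesis by (simp add: l2_norm_def)
qed

lemma l2_norm_zero: "l2_norm 0 = 0"
  by (simp add: l2_norm_def tau_zero)

lemma l2_norm_eq_0: "l2_norm x = 0 \<longleftrightarrow> x = 0"
  using tau_faithful[of x] tau_square[of x] by auto

lemma l2_Cauchy_Schwarz: "cmod (tau (star x * y)) \<le> l2_norm x * l2_norm y"
proof (cases "x = 0")
  case True
  then show ?thesis by (simp add: star_zero tau_zero l2_norm_zero)
next
  case False
  define a where "a = tau (star x * y)"
  define N where "N = (l2_norm x)\<^sup>2"
  have N: "N > 0" using False l2_norm_eq_0[of x] by (simp add: N_def)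
  define c where "c = a / complex_of_real N"
  define z where "z = y - c *\<^sub>C x"
  have xx: "tau (star x * x) = complex_of_real N" by (simp add: N_def tau_square)
  have yx: "tau (star y * x) = cnj a" unfolding a_def by (rule tau_inner_commute)
  have "tau (star z * z) = tau (star y * y) - c * tau (star y * x) - cnj c * tau (star x * y)
      + cnj c * (c * tau (star x * x))"
    unfolding z_def star_diff star_scale
    by (simp add: algebra_simps tau_diff tau_add tau_scale scale_mult_left scale_mult_right)
  also have "\<dots> = complex_of_real ((l2_norm y)\<^sup>2) - (a * cnj a) / N"
    using N unfolding xx yx a_def[symmetric] tau_square[of y]
    by (simp add: c_def field_simps)
  also have "\<dots> = complex_of_real ((l2_norm y)\<^sup>2 - (cmod a)\<^sup>2 / N)"
    by (simp flip: complex_norm_square)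
  finally have "complex_of_real ((l2_norm z)\<^sup>2) = complex_of_real ((l2_norm y)\<^sup>2 - (cmod a)\<^sup>2 / N)"
    by (simp only: tau_square)
  then have "(l2_norm z)\<^sup>2 = (l2_norm y)\<^sup>2 - (cmod a)\<^sup>2 / N"
    by (simp only: of_real_eq_iff)
  then have "(cmod a)\<^sup>2 / N \<le> (l2_norm y)\<^sup>2"
    using zero_le_power2[of "l2_norm z"] by linarith
  then have "(cmod a)\<^sup>2 \<le> (l2_norm x * l2_norm y)\<^sup>2"
    using N by (simp add: pos_divide_le_eq power_mult_distrib N_def mult.commute)
  then show ?thesis
    unfolding a_def by (rule power2_le_imp_le) (simp add: l2_norm_nonneg)
qed

lemma l2_norm_triangle: "l2_norm (x + y) \<le> l2_norm x + l2_norm y"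
proof -
  have "tau (star (x + y) * (x + y)) =
      tau (star x * x) + tau (star x * y) + cnj (tau (star x * y)) + tau (star y * y)"
    unfolding star_add tau_inner_commute[of y x, symmetric]
    by (simp add: algebra_simps tau_add)
  then have "Re (complex_of_real ((l2_norm (x + y))\<^sup>2)) =
      Re (complex_of_real ((l2_norm x)\<^sup>2) + tau (star x * y) + cnj (tau (star x * y))
        + complex_of_real ((l2_norm y)\<^sup>2))"
    by (simp only: tau_square)
  then have "(l2_norm (x + y))\<^sup>2 = (l2_norm x)\<^sup>2 + 2 * Re (tau (star x * y)) + (l2_norm y)\<^sup>2"
    by simp
  also have "\<dots> \<le> (l2_norm x)\<^sup>2 + 2 * (l2_norm x * l2_norm y) + (l2_norm y)\<^sup>2"
    using complex_Re_le_cmod[of "tau (star x * y)"] l2_Cauchy_Schwarz[of x y] by linarith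
  also have "\<dots> = (l2_norm x + l2_norm y)\<^sup>2" by (simp add: power2_sum)
  finally show ?thesis
    by (rule power2_le_imp_le) (simp add: l2_norm_nonneg)
qed

lemma l2_norm_minus: "l2_norm (- x) = l2_norm x"
  by (simp add: l2_norm_def star_minus)

lemma l2_norm_diff_commute: "l2_norm (x - y) = l2_norm (y - x)"
  using l2_norm_minus[of "x - y"] by simp

lemma l2_norm_triangle_diff: "l2_norm (x - z) \<le> l2_norm (x - y) + l2_norm (y - z)"
  using l2_norm_triangle[of "x - y" "y - z"] by simp

lemma l2_norm_diff_diff: "l2_norm ((x - y) - (x' - y')) \<le> l2_norm (x - x') + l2_norm (y - y')"
  using l2_norm_triangle[of "x - x'" "- (y - y')"]
  by (simp add: l2_norm_diff_commute algebra_simps)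

lemma equiv_L2_rel: "equiv {X. l2_Cauchy X} L2_rel"
proof (rule equivI)
  show "L2_rel \<subseteq> {X. l2_Cauchy X} \<times> {X. l2_Cauchy X}"
    by (auto simp: L2_rel_def)
  show "refl_on {X. l2_Cauchy X} L2_rel"
    by (auto simp: refl_on_def L2_rel_def l2_norm_zero)
  show "sym L2_rel"
    by (auto simp: sym_def L2_rel_def l2_norm_diff_commute)
  show "trans L2_rel"
  proof (rule transI)
    fix X Y Z assume "(X, Y) \<in> L2_rel" "(Y, Z) \<in> L2_rel"
    then have *: "l2_Cauchy X" "l2_Cauchy Z"
      and "(\<lambda>k. l2_norm (X k - Y k)) \<longlonglongrightarrow> 0" "(\<lambda>k. l2_norm (Y k - Z k)) \<longlonglongrightarrow> 0"
      by (auto simp: L2_rel_def)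
    then have "(\<lambda>k. l2_norm (X k - Y k) + l2_norm (Y k - Z k)) \<longlonglongrightarrow> 0"
      using tendsto_add by fastforce
    then have "(\<lambda>k. l2_norm (X k - Z k)) \<longlonglongrightarrow> 0"
      by (rule real_tendsto_sandwich[rotated 3])
         (auto simp: l2_norm_nonneg l2_norm_triangle_diff)
    with * show "(X, Z) \<in> L2_rel" by (simp add: L2_rel_def)
  qed
qed

lemma l2_Cauchy_const: "l2_Cauchy (\<lambda>_. a)"
  by (auto simp: l2_Cauchy_def l2_norm_zero)

lemma L2_emb_in_L2: "L2_emb a \<in> L2"
  unfolding L2_emb_def L2_def by (rule quotientI) (simp add: l2_Cauchy_const)

lemma l2_Cauchy_diff:
  assumes "l2_Cauchy X" "l2_Cauchy Y"
  shows "l2_Cauchy (\<lambda>k. X k - Y k)"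
  unfolding l2_Cauchy_def
proof (intro allI impI)
  fix e :: real assume "e > 0"
  then have e: "e / 2 > 0" by simp
  obtain N1 where N1: "\<forall>j\<ge>N1. \<forall>k\<ge>N1. l2_norm (X j - X k) < e / 2"
    using assms(1) e unfolding l2_Cauchy_def by blast
  obtain N2 where N2: "\<forall>j\<ge>N2. \<forall>k\<ge>N2. l2_norm (Y j - Y k) < e / 2"
    using assms(2) e unfolding l2_Cauchy_def by blast
  have "l2_norm ((X j - Y j) - (X k - Y k)) < e" if "j \<ge> max N1 N2" "k \<ge> max N1 N2" for j k
  proof -
    have "l2_norm (X j - X k) < e / 2" "l2_norm (Y j - Y k) < e / 2" using N1 N2 that by auto
    then show ?thesis using l2_norm_diff_diff[of "X j" "Y j" "X k" "Y k"] by linarith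
  qed
  then show "\<exists>N. \<forall>j\<ge>N. \<forall>k\<ge>N. l2_norm ((X j - Y j) - (X k - Y k)) < e" by blast
qed

lemma L2_minus_class:
  assumes "l2_Cauchy X" "l2_Cauchy Y"
  shows "L2_minus (L2_rel `` {X}) (L2_rel `` {Y}) = L2_rel `` {\<lambda>k. X k - Y k}"
  unfolding L2_minus_def
proof (rule UN_equiv_class2[OF equiv_L2_rel equiv_L2_rel])
  show "congruent2 L2_rel L2_rel (\<lambda>X Y. L2_rel `` {\<lambda>k. X k - Y k})"
  proof (rule congruent2I')
    fix X X' Y Y' assume "(X, X') \<in> L2_rel" "(Y, Y') \<in> L2_rel"
    then have *: "l2_Cauchy X" "l2_Cauchy X'" "l2_Cauchy Y" "l2_Cauchy Y'"
      and "(\<lambda>k. l2_norm (X k - X' k)) \<longlonglongrightarrow> 0" "(\<lambda>k. l2_norm (Y k - Y' k)) \<longlonglongrightarrow> 0"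
      by (auto simp: L2_rel_def)
    then have "(\<lambda>k. l2_norm (X k - X' k) + l2_norm (Y k - Y' k)) \<longlonglongrightarrow> 0"
      using tendsto_add by fastforce
    then have "(\<lambda>k. l2_norm ((X k - Y k) - (X' k - Y' k))) \<longlonglongrightarrow> 0"
      by (rule real_tendsto_sandwich[rotated 3])
         (auto simp: l2_norm_nonneg l2_norm_diff_diff)
    then have "(\<lambda>k. X k - Y k, \<lambda>k. X' k - Y' k) \<in> L2_rel"
      using * by (simp add: L2_rel_def l2_Cauchy_diff)
    then show "L2_rel `` {\<lambda>k. X k - Y k} = L2_rel `` {\<lambda>k. X' k - Y' k}"
      by (rule equiv_class_eq[OF equiv_L2_rel])
  qed
qed (use assms in auto)

lemma l2_Cauchy_bounded:
  assumes "l2_Cauchy X"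
  obtains B where "B > 0" "\<And>k. l2_norm (X k) \<le> B"
proof -
  obtain N where N: "\<forall>j\<ge>N. \<forall>k\<ge>N. l2_norm (X j - X k) < 1"
    using assms unfolding l2_Cauchy_def by (meson zero_less_one)
  define B where "B = Max ((\<lambda>k. l2_norm (X k)) ` {..N}) + 1"
  have le: "l2_norm (X k) \<le> B - 1" if "k \<le> N" for k
    using that unfolding B_def by simp
  have "l2_norm (X k) \<le> B" for k
  proof (cases "k \<le> N")
    case True
    then show ?thesis using le by fastforce
  next
    case False
    then have "l2_norm (X k - X N) < 1" using N by simp
    then show ?thesis using l2_norm_triangle[of "X k - X N" "X N"] le[of N] by simp
  qed
  moreover have "B > 0" using le[of 0] l2_norm_nonneg[of "X 0"] by simp
  ultimately show ?thesis using that by blast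
qed

lemma tau_inner_diff_le:
  "cmod (tau (star x * y) - tau (star x' * y')) \<le>
     l2_norm (x - x') * l2_norm y + l2_norm x' * l2_norm (y - y')"
proof -
  have *: "tau (star x * y) - tau (star x' * y') =
      tau (star (x - x') * y) + tau (star x' * (y - y'))"
    by (simp add: star_diff algebra_simps tau_diff)
  show ?thesis
    unfolding * using norm_triangle_ineq[of "tau (star (x - x') * y)" "tau (star x' * (y - y'))"]
      l2_Cauchy_Schwarz[of "x - x'" y] l2_Cauchy_Schwarz[of x' "y - y'"] by linarith
qed

lemma convergent_tau_inner:
  assumes X: "l2_Cauchy X" and Y: "l2_Cauchy Y"
  shows "convergent (\<lambda>k. tau (star (X k) * Y k))"
proof -
  obtain B where B: "B > 0" "\<And>k. l2_norm (X k) \<le> B" using X by (rule l2_Cauchy_bounded) blast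
  obtain C where C: "C > 0" "\<And>k. l2_norm (Y k) \<le> C" using Y by (rule l2_Cauchy_bounded) blast
  have "Cauchy (\<lambda>k. tau (star (X k) * Y k))"
  proof (rule CauchyI)
    fix e :: real assume e: "e > 0"
    obtain N1 where N1: "\<forall>j\<ge>N1. \<forall>k\<ge>N1. l2_norm (X j - X k) < e / (2 * C)"
      using X e C(1) unfolding l2_Cauchy_def by (meson divide_pos_pos mult_pos_pos zero_less_numeral)
    obtain N2 where N2: "\<forall>j\<ge>N2. \<forall>k\<ge>N2. l2_norm (Y j - Y k) < e / (2 * B)"
      using Y e B(1) unfolding l2_Cauchy_def by (meson divide_pos_pos mult_pos_pos zero_less_numeral)
    have "norm (tau (star (X j) * Y j) - tau (star (X k) * Y k)) < e"
      if "j \<ge> max N1 N2" "k \<ge> max N1 N2" for j k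
    proof -
      have 1: "l2_norm (X j - X k) < e / (2 * C)" and 2: "l2_norm (Y j - Y k) < e / (2 * B)"
        using N1 N2 that by auto
      have "l2_norm (X j - X k) * l2_norm (Y j) \<le> l2_norm (X j - X k) * C"
        using C by (simp add: mult_left_mono l2_norm_nonneg)
      also have "\<dots> < e / 2" using 1 C(1) by (simp add: field_simps)
      finally have "l2_norm (X j - X k) * l2_norm (Y j) < e / 2" .
      moreover have "l2_norm (X k) * l2_norm (Y j - Y k) \<le> B * l2_norm (Y j - Y k)"
        using B by (simp add: mult_right_mono l2_norm_nonneg)
      moreover have "B * l2_norm (Y j - Y k) < e / 2" using 2 B(1) by (simp add: field_simps)
      ultimately show ?thesis using tau_inner_diff_le[of "X j" "Y j" "X k" "Y k"] by linarith
    qed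
    then show "\<exists>M. \<forall>j\<ge>M. \<forall>k\<ge>M. norm (tau (star (X j) * Y j) - tau (star (X k) * Y k)) < e"
      by blast
  qed
  then show ?thesis by (simp add: Cauchy_convergent_iff)
qed

lemma L2_inner_class:
  assumes "l2_Cauchy X" "l2_Cauchy Y"
  shows "L2_inner (L2_rel `` {X}) (L2_rel `` {Y}) = lim (\<lambda>k. tau (star (X k) * Y k))"
proof -
  have "(\<Union>X\<in>L2_rel `` {X}. \<Union>Y\<in>L2_rel `` {Y}. {lim (\<lambda>k. tau (star (X k) * Y k))})
      = {lim (\<lambda>k. tau (star (X k) * Y k))}"
  proof (rule UN_equiv_class2[OF equiv_L2_rel equiv_L2_rel])
    show "congruent2 L2_rel L2_rel (\<lambda>X Y. {lim (\<lambda>k. tau (star (X k) * Y k))})"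
    proof (rule congruent2I')
      fix X X' Y Y' assume "(X, X') \<in> L2_rel" "(Y, Y') \<in> L2_rel"
      then have *: "l2_Cauchy X" "l2_Cauchy X'" "l2_Cauchy Y" "l2_Cauchy Y'"
        and lims: "(\<lambda>k. l2_norm (X k - X' k)) \<longlonglongrightarrow> 0" "(\<lambda>k. l2_norm (Y k - Y' k)) \<longlonglongrightarrow> 0"
        by (auto simp: L2_rel_def)
      obtain B where B: "B > 0" "\<And>k. l2_norm (X' k) \<le> B" using *(2) by (rule l2_Cauchy_bounded) blast
      obtain C where C: "C > 0" "\<And>k. l2_norm (Y k) \<le> C" using *(3) by (rule l2_Cauchy_bounded) blast
      have "(\<lambda>k. l2_norm (X k - X' k) * C + B * l2_norm (Y k - Y' k)) \<longlonglongrightarrow> 0 * C + B * 0"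
        by (intro tendsto_intros lims)
      then have *: "(\<lambda>k. l2_norm (X k - X' k) * C + B * l2_norm (Y k - Y' k)) \<longlonglongrightarrow> 0" by simp
      have "norm (tau (star (X k) * Y k) - tau (star (X' k) * Y' k))
          \<le> l2_norm (X k - X' k) * C + B * l2_norm (Y k - Y' k)" for k
      proof -
        have "l2_norm (X k - X' k) * l2_norm (Y k) \<le> l2_norm (X k - X' k) * C"
          using C by (simp add: mult_left_mono l2_norm_nonneg)
        moreover have "l2_norm (X' k) * l2_norm (Y k - Y' k) \<le> B * l2_norm (Y k - Y' k)"
          using B by (simp add: mult_right_mono l2_norm_nonneg)
        ultimately show ?thesis using tau_inner_diff_le[of "X k" "Y k" "X' k" "Y' k"] by linarith
      qed
      then have d: "(\<lambda>k. tau (star (X k) * Y k) - tau (star (X' k) * Y' k)) \<longlonglongrightarrow> 0"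
        by (intro Lim_null_comparison[OF _ *] always_eventually) auto
      obtain l where l: "(\<lambda>k. tau (star (X' k) * Y' k)) \<longlonglongrightarrow> l"
        using convergent_tau_inner \<open>l2_Cauchy X'\<close> \<open>l2_Cauchy Y'\<close> unfolding convergent_def by blast
      have "(\<lambda>k. tau (star (X k) * Y k)) \<longlonglongrightarrow> l"
        using tendsto_add[OF d l] by simp
      then show "{lim (\<lambda>k. tau (star (X k) * Y k))} = {lim (\<lambda>k. tau (star (X' k) * Y' k))}"
        using l by (simp add: limI)
    qed
  qed (use assms in auto)
  then show ?thesis by (simp add: L2_inner_def)
qed

lemma L2_inner_emb: "L2_inner (L2_emb a) (L2_emb b) = tau (star a * b)"
  unfolding L2_emb_def by (simp add: L2_inner_class l2_Cauchy_const)

end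

end

theory Submission
  imports Defs
begin

text \<open>
  Let \<open>a\<close> be a polynomial in \<open>s\<^sub>n\<close> and \<open>b = G(s\<^sub>m)\<close> a centred polynomial in \<open>s\<^sub>m\<close>. Free identically
  distributed variables are exchangeable, so \<open>\<langle>a, b\<rangle> = \<langle>a, b\<^sub>j\<rangle>\<close> for the cyclic shifts
  \<open>b\<^sub>j = G(\<Sum>i<m. x ((i + j) mod n))\<close>, and by Cauchy-Schwarz it suffices that
  \<open>\<parallel>\<Sum>j<n. b\<^sub>j\<parallel>\<^sup>2 \<le> m n \<parallel>b\<parallel>\<^sup>2\<close>. Split each \<open>b\<^sub>j\<close> into the \<open>m\<close> parts spanned by alternating
  products of centred elements with a given first letter. By freeness, parts with different first
  letters are orthogonal. For fixed \<open>i\<close>, the parts of the \<open>b\<^sub>j\<close> whose first letter is the shift of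
  \<open>i\<close> have different first letters as \<open>j\<close> varies, so the norms add up, and
  \<open>\<parallel>\<Sum>i<m. v\<^sub>i\<parallel>\<^sup>2 \<le> m (\<Sum>i<m. \<parallel>v\<^sub>i\<parallel>\<^sup>2)\<close> gives the claim. The bound passes to the \<open>L\<^sup>2\<close> closures
  and is attained at \<open>(s\<^sub>n, s\<^sub>m)\<close>.
\<close>

context tracial_prob_space
begin

section \<open>Finite sums and the 2-norm on the algebra\<close>

lemma tau_sum: "tau (sum f A) = (\<Sum>i\<in>A. tau (f i))"
  by (induction A rule: infinite_finite_induct) (auto simp: tau_zero tau_add)

lemma star_sum: "star (sum f A) = (\<Sum>i\<in>A. star (f i))"
  by (induction A rule: infinite_finite_induct) (auto simp: star_zero star_add)

lemma star_one: "star 1 = 1"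
  by (metis mult.right_neutral star_mult star_star)

lemma star_prod_list: "star (prod_list as) = prod_list (rev (map star as))"
  by (induction as) (auto simp: star_one star_mult)

lemma l2_norm_eqI: "tau (star a * a) = tau (star b * b) \<Longrightarrow> l2_norm a = l2_norm b"
  by (simp add: l2_norm_def)

lemma l2_norm_sum_le: "l2_norm (sum f A) \<le> (\<Sum>i\<in>A. l2_norm (f i))"
proof (induction A rule: infinite_finite_induct)
  case (insert i A)
  then show ?case using l2_norm_triangle[of "f i" "sum f A"] by simp
qed (auto simp: l2_norm_zero)

text \<open>The triangle inequality followed by the scalar Cauchy-Schwarz inequality. The factor
  \<open>card A\<close> becomes the \<open>m\<close> of the correlation bound.\<close>

lemma l2_norm_sum_squared_le: "(l2_norm (sum f A))\<^sup>2 \<le> card A * (\<Sum>i\<in>A. (l2_norm (f i))\<^sup>2)"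
proof -
  have "(l2_norm (sum f A))\<^sup>2 \<le> (\<Sum>i\<in>A. l2_norm (f i))\<^sup>2"
    by (intro power_mono l2_norm_sum_le l2_norm_nonneg)
  also have "\<dots> \<le> (\<Sum>i\<in>A. (l2_norm (f i))\<^sup>2) * card A"
    by (rule sum_squared_le_sum_of_squares)
  finally show ?thesis by (simp add: mult.commute)
qed

lemma l2_norm_pythagoras:
  assumes "\<And>i j. i \<in> A \<Longrightarrow> j \<in> A \<Longrightarrow> i \<noteq> j \<Longrightarrow> tau (star (f i) * f j) = 0"
  shows "(l2_norm (sum f A))\<^sup>2 = (\<Sum>i\<in>A. (l2_norm (f i))\<^sup>2)"
proof (cases "finite A")
  case True
  have "complex_of_real ((l2_norm (sum f A))\<^sup>2) = tau (star (sum f A) * sum f A)"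
    by (simp only: tau_square)
  also have "\<dots> = (\<Sum>i\<in>A. \<Sum>j\<in>A. tau (star (f i) * f j))"
    by (simp add: star_sum sum_product tau_sum)
  also have "\<dots> = (\<Sum>i\<in>A. \<Sum>j\<in>A. if i = j then tau (star (f i) * f i) else 0)"
    using assms by (intro sum.cong refl) auto
  also have "\<dots> = (\<Sum>i\<in>A. tau (star (f i) * f i))"
    using True by simp
  also have "\<dots> = complex_of_real (\<Sum>i\<in>A. (l2_norm (f i))\<^sup>2)"
    by (simp add: tau_square)
  finally show ?thesis by (simp only: of_real_eq_iff)
qed (simp add: l2_norm_zero)

section \<open>Polynomials in one variable and its adjoint\<close>

lemma star_polys_one: "1 \<in> star_polys y"
  unfolding star_polys_def by (rule span_base) (auto intro: exI[of _ "[]"])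

lemma star_polys_self: "y \<in> star_polys y"
  unfolding star_polys_def by (rule span_base) (auto intro: exI[of _ "[y]"])

lemma star_polys_add: "a \<in> star_polys y \<Longrightarrow> b \<in> star_polys y \<Longrightarrow> a + b \<in> star_polys y"
  unfolding star_polys_def by (rule span_add)

lemma star_polys_diff: "a \<in> star_polys y \<Longrightarrow> b \<in> star_polys y \<Longrightarrow> a - b \<in> star_polys y"
  unfolding star_polys_def by (rule span_diff)

lemma star_polys_scale: "a \<in> star_polys y \<Longrightarrow> c *\<^sub>C a \<in> star_polys y"
  unfolding star_polys_def by (rule span_scale)

text \<open>Words are built by adding letters on the left, so an induction only has to treat one
  generator at a time.\<close>

lemma star_polys_induct [consumes 1, case_names one mult star_mult add scale]:
  assumes "a \<in> star_polys y"
    and "P 1"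
    and "\<And>a. P a \<Longrightarrow> P (y * a)"
    and "\<And>a. P a \<Longrightarrow> P (star y * a)"
    and "\<And>a b. P a \<Longrightarrow> P b \<Longrightarrow> P (a + b)"
    and "\<And>c a. P a \<Longrightarrow> P (c *\<^sub>C a)"
  shows "P a"
proof -
  have word: "P (prod_list w)" if "set w \<subseteq> {y, star y}" for w
    using that assms(2-4) by (induction w) auto
  show ?thesis
    using assms(1) unfolding star_polys_def
  proof (induction rule: span_induct_alt)
    case base
    \<comment> \<open>The zero element is reached as 0 times the unit.\<close>
    show ?case using assms(6)[OF assms(2), of 0] by simp
  next
    case (step c a b)
    then show ?case using word assms(5,6) by auto
  qed
qed

lemma star_polys_mult:
  assumes "z \<in> {y, star y}" "a \<in> star_polys y"
  shows "z * a \<in> star_polys y"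
  using assms(2) unfolding star_polys_def
proof (induction rule: span_induct_alt)
  case base
  show ?case by (simp add: span_zero)
next
  case (step c a b)
  then obtain w where w: "a = prod_list w" "set w \<subseteq> {y, star y}" by auto
  have "z * a \<in> span {prod_list w | w. set w \<subseteq> {y, star y}}"
    using w assms(1) by (intro span_base) (auto intro!: exI[of _ "z # w"])
  with step show ?case by (simp add: distrib_left scale_mult_right span_add span_scale)
qed

lemma star_polys_mult_right:
  assumes "z \<in> {y, star y}" "a \<in> star_polys y"
  shows "a * z \<in> star_polys y"
  using assms(2) unfolding star_polys_def
proof (induction rule: span_induct_alt)
  case base
  show ?case by (simp add: span_zero)
next
  case (step c a b)
  then obtain w where w: "a = prod_list w" "set w \<subseteq> {y, star y}" by auto
  have "a * z \<in> span {prod_list w | w. set w \<subseteq> {y, star y}}"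
    using w assms(1) by (intro span_base) (auto intro!: exI[of _ "w @ [z]"])
  with step show ?case by (simp add: distrib_right scale_mult_left span_add span_scale)
qed

lemma star_polys_star:
  assumes "a \<in> star_polys y"
  shows "star a \<in> star_polys y"
  using assms
  by (induction rule: star_polys_induct)
     (auto simp: star_one star_mult star_add star_scale star_star star_polys_one
       intro: star_polys_add star_polys_scale star_polys_mult_right)

text \<open>The definition compares nonempty words only; for the empty word both sides are
  \<open>tau 1\<close>. Index 0 stands for the variable and index 1 for its adjoint.\<close>

lemma identically_distributed_word:
  assumes "identically_distributed y z" "set w \<subseteq> {..<2}"
  shows "tau (prod_list (map ((!) [y, star y]) w)) = tau (prod_list (map ((!) [z, star z]) w))"
  using assms by (cases "w = []") (auto simp: identically_distributed_def same_distribution_def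
      numeral_2_eq_2)

lemma identically_distributed_moments:
  assumes "identically_distributed y z"
  shows "tau y = tau z" "tau (star y * y) = tau (star z * z)"
  using identically_distributed_word[OF assms, of "[0]"]
    identically_distributed_word[OF assms, of "[1, 0]"] by simp_all

subsection \<open>Approximation in the completion\<close>

lemma l2_norm_L2_class:
  assumes "l2_Cauchy X"
  shows "(\<lambda>k. l2_norm (X k)) \<longlonglongrightarrow> L2_norm (L2_rel `` {X})"
proof -
  have "(\<lambda>k. tau (star (X k) * X k)) \<longlonglongrightarrow> L2_inner (L2_rel `` {X}) (L2_rel `` {X})"
    using convergent_tau_inner[OF assms assms]
    by (simp add: L2_inner_class[OF assms assms] convergent_LIMSEQ_iff)
  then show ?thesis
    unfolding L2_norm_def l2_norm_def by (intro tendsto_intros)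
qed

lemma tau_inner_L2_class:
  assumes "l2_Cauchy X" "l2_Cauchy Y"
  shows "(\<lambda>k. tau (star (X k) * Y k)) \<longlonglongrightarrow> L2_inner (L2_rel `` {X}) (L2_rel `` {Y})"
  using convergent_tau_inner[OF assms]
  by (simp add: L2_inner_class[OF assms] convergent_LIMSEQ_iff)

lemma l2_Cauchy_null:
  assumes "(\<lambda>k. l2_norm (Z k)) \<longlonglongrightarrow> 0"
  shows "l2_Cauchy Z"
  unfolding l2_Cauchy_def
proof (intro allI impI)
  fix e :: real assume "e > 0"
  then have "\<forall>\<^sub>F k in sequentially. l2_norm (Z k) < e / 2"
    using assms by (intro order_tendstoD) auto
  then obtain N where N: "\<And>k. k \<ge> N \<Longrightarrow> l2_norm (Z k) < e / 2"
    by (auto simp: eventually_sequentially)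
  have "l2_norm (Z j - Z k) < e" if "j \<ge> N" "k \<ge> N" for j k
    using N[OF that(1)] N[OF that(2)] l2_norm_triangle[of "Z j" "- Z k"]
    by (simp add: l2_norm_minus)
  then show "\<exists>N. \<forall>j\<ge>N. \<forall>k\<ge>N. l2_norm (Z j - Z k) < e" by blast
qed

lemma L2_class_eqI:
  assumes "l2_Cauchy X" "(\<lambda>k. l2_norm (X k - Y k)) \<longlonglongrightarrow> 0"
  shows "l2_Cauchy Y" "L2_rel `` {X} = L2_rel `` {Y}"
proof -
  have "l2_Cauchy (\<lambda>k. X k - (X k - Y k))"
    by (intro l2_Cauchy_diff l2_Cauchy_null assms)
  then show Y: "l2_Cauchy Y" by simp
  show "L2_rel `` {X} = L2_rel `` {Y}"
    using assms Y by (intro equiv_class_eq[OF equiv_L2_rel]) (simp add: L2_rel_def)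
qed

text \<open>Choosing \<open>P k\<close> within 1/(k+1) of the given vector yields a representative
  of that vector lying in \<open>S\<close>. Inequalities proved on \<open>S\<close> can then be
  passed to the limit along it.\<close>

lemma L2_closure_emb_sequence:
  assumes "\<xi> \<in> L2_closure (L2_emb ` S)"
  obtains P where "l2_Cauchy P" "\<And>k. P k \<in> S" "\<xi> = L2_rel `` {P}"
proof -
  have "\<xi> \<in> L2" and dense: "\<And>e. e > 0 \<Longrightarrow> \<exists>p\<in>S. L2_norm (L2_minus \<xi> (L2_emb p)) < e"
    using assms by (auto simp: L2_closure_def)
  then obtain X where X: "l2_Cauchy X" "\<xi> = L2_rel `` {X}"
    by (auto simp: L2_def elim!: quotientE)
  have "\<exists>p\<in>S. L2_norm (L2_minus \<xi> (L2_emb p)) < inverse (real (Suc k))" for k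
    by (rule dense) simp
  then obtain P where P: "\<And>k. P k \<in> S"
    "\<And>k. L2_norm (L2_minus \<xi> (L2_emb (P k))) < inverse (real (Suc k))" by metis
  have lim: "(\<lambda>l. l2_norm (X l - P k)) \<longlonglongrightarrow> L2_norm (L2_minus \<xi> (L2_emb (P k)))" for k
    using l2_norm_L2_class[OF l2_Cauchy_diff[OF X(1) l2_Cauchy_const[of "P k"]]]
    by (simp add: X L2_emb_def L2_minus_class l2_Cauchy_const)
  have ev: "\<forall>\<^sub>F l in sequentially. l2_norm (X l - P k) < inverse (real (Suc k))" for k
    using order_tendstoD(2)[OF lim P(2)] .
  have "(\<lambda>k. l2_norm (X k - P k)) \<longlonglongrightarrow> 0"
  proof (rule LIMSEQ_I)
    fix e :: real assume e: "e > 0"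
    then obtain N where N: "\<forall>j\<ge>N. \<forall>k\<ge>N. l2_norm (X j - X k) < e / 2"
      using X(1) unfolding l2_Cauchy_def by (meson half_gt_zero)
    obtain M where M: "inverse (real (Suc M)) < e / 2"
      using reals_Archimedean[of "e / 2"] e by auto
    have "l2_norm (X k - P k) < e" if k: "k \<ge> max N M" for k
    proof -
      \<comment> \<open>The auxiliary index \<open>l\<close> links the two estimates:
        \<open>X l\<close> is close to \<open>X k\<close> by the Cauchy property and close to
        \<open>P k\<close> by the choice of \<open>P\<close>.\<close>
      obtain l where l: "l \<ge> N" "l2_norm (X l - P k) < inverse (real (Suc k))"
        using ev[of k] unfolding eventually_sequentially by (meson linear order_trans)
      have "inverse (real (Suc k)) \<le> inverse (real (Suc M))"
        using k by (intro le_imp_inverse_le) auto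
      moreover have "l2_norm (X k - X l) < e / 2" using N k l by auto
      ultimately show ?thesis
        using l2_norm_triangle_diff[of "X k" "P k" "X l"] l M by linarith
    qed
    then show "\<exists>no. \<forall>k\<ge>no. norm (l2_norm (X k - P k) - 0) < e"
      by (intro exI[of _ "max N M"]) (simp add: l2_norm_nonneg)
  qed
  from L2_class_eqI[OF X(1) this] show ?thesis
    using that P X by auto
qed

lemma l2_norm_scale_one: "l2_norm (c *\<^sub>C 1) = cmod c"
proof -
  have "complex_of_real ((l2_norm (c *\<^sub>C 1))\<^sup>2) = complex_of_real ((cmod c)\<^sup>2)"
    unfolding tau_square[symmetric]
    by (simp add: star_scale star_one scale_mult_left tau_scale tau_one complex_norm_square
        mult.commute del: of_real_power)
  then show ?thesis by (simp only: of_real_eq_iff) (simp add: l2_norm_nonneg)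
qed

text \<open>The terms must have trace exactly 0 for the polynomial bound to apply. Hence each
  approximant is centred by its own trace; this differs from subtracting the limiting trace by a
  scalar that tends to 0.\<close>

lemma centered_L2_of:
  assumes "\<xi> \<in> L2_of y"
  obtains Q where "l2_Cauchy Q" "\<And>k. Q k \<in> star_polys y" "\<And>k. tau (Q k) = 0"
    "centered \<xi> = L2_rel `` {Q}"
proof -
  obtain P where P: "l2_Cauchy P" "\<And>k. P k \<in> star_polys y" "\<xi> = L2_rel `` {P}"
    using assms unfolding L2_of_def by (rule L2_closure_emb_sequence) blast
  have lim: "(\<lambda>k. tau (P k)) \<longlonglongrightarrow> L2_tau \<xi>"
    using tau_inner_L2_class[OF l2_Cauchy_const[of 1] P(1)]
    by (simp add: L2_tau_def L2_emb_def P(3) star_one)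
  define Q where "Q k = P k - tau (P k) *\<^sub>C 1" for k
  have c: "centered \<xi> = L2_rel `` {\<lambda>k. P k - L2_tau \<xi> *\<^sub>C 1}"
    using L2_minus_class[OF P(1) l2_Cauchy_const] by (simp add: centered_def L2_emb_def P(3))
  have C: "l2_Cauchy (\<lambda>k. P k - L2_tau \<xi> *\<^sub>C 1)"
    by (intro l2_Cauchy_diff P l2_Cauchy_const)
  have "(P k - L2_tau \<xi> *\<^sub>C 1) - Q k = (tau (P k) - L2_tau \<xi>) *\<^sub>C 1" for k
    by (simp add: Q_def scale_left_diff_distrib)
  then have "(\<lambda>k. l2_norm ((P k - L2_tau \<xi> *\<^sub>C 1) - Q k)) = (\<lambda>k. cmod (tau (P k) - L2_tau \<xi>))"
    by (simp add: l2_norm_scale_one)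
  also have "\<dots> \<longlonglongrightarrow> 0"
    using lim by (simp add: LIM_zero tendsto_norm_zero)
  finally have "(\<lambda>k. l2_norm ((P k - L2_tau \<xi> *\<^sub>C 1) - Q k)) \<longlonglongrightarrow> 0" .
  note Q = L2_class_eqI[OF C this]
  show ?thesis
  proof (rule that)
    show "l2_Cauchy Q" by (rule Q)
    show "Q k \<in> star_polys y" "tau (Q k) = 0" for k
      using P(2) by (auto simp: Q_def tau_diff tau_scale tau_one
          intro: star_polys_diff star_polys_scale star_polys_one)
    show "centered \<xi> = L2_rel `` {Q}" using c Q(2) by simp
  qed
qed

lemma L2_emb_in_L2_of: "a \<in> star_polys y \<Longrightarrow> L2_emb a \<in> L2_of y"
  using L2_minus_class[OF l2_Cauchy_const[of a] l2_Cauchy_const[of a]]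
  by (auto simp: L2_of_def L2_closure_def L2_emb_in_L2 L2_norm_def L2_inner_emb tau_zero
      simp flip: L2_emb_def intro!: bexI[of _ a])

lemma cov_emb:
  "cov (L2_emb a) (L2_emb b) = tau (star (a - tau a *\<^sub>C 1) * (b - tau b *\<^sub>C 1))"
proof -
  have "centered (L2_emb a) = L2_emb (a - tau a *\<^sub>C 1)" for a
    using L2_minus_class[OF l2_Cauchy_const[of a] l2_Cauchy_const[of "tau a *\<^sub>C 1"]]
    by (simp add: centered_def L2_tau_def L2_inner_emb star_one flip: L2_emb_def)
  then show ?thesis by (simp add: cov_def L2_inner_emb)
qed

lemma sigma_eq: "sigma \<xi> = L2_norm (centered \<xi>)"
  by (simp add: sigma_def L2_norm_def cov_def)

text \<open>Reduces the correlation bound on the closures to one on polynomials: both centred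
  vectors are approximated by polynomials, and norms and inner products converge.\<close>

lemma Re_rho_le:
  assumes bound: "\<And>a b. a \<in> star_polys y \<Longrightarrow> b \<in> star_polys z \<Longrightarrow> tau b = 0 \<Longrightarrow>
      cmod (tau (star a * b)) \<le> r * (l2_norm a * l2_norm b)"
    and \<xi>: "\<xi> \<in> L2_of y" "sigma \<xi> \<noteq> 0" and \<eta>: "\<eta> \<in> L2_of z" "sigma \<eta> \<noteq> 0"
  shows "Re (rho \<xi> \<eta>) \<le> r"
proof -
  obtain P where P: "l2_Cauchy P" "\<And>k. P k \<in> star_polys y" "centered \<xi> = L2_rel `` {P}"
    using \<xi>(1) by (rule centered_L2_of) blast
  obtain Q where Q: "l2_Cauchy Q" "\<And>k. Q k \<in> star_polys z" "\<And>k. tau (Q k) = 0"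
    "centered \<eta> = L2_rel `` {Q}"
    using \<eta>(1) by (rule centered_L2_of) blast
  have lim: "(\<lambda>k. l2_norm (P k)) \<longlonglongrightarrow> sigma \<xi>" "(\<lambda>k. l2_norm (Q k)) \<longlonglongrightarrow> sigma \<eta>"
    using l2_norm_L2_class[OF P(1)] l2_norm_L2_class[OF Q(1)] by (simp_all add: sigma_eq P Q)
  \<comment> \<open>As limits of norms both values are nonnegative, and they are nonzero by
    assumption.\<close>
  have pos: "sigma \<xi> > 0" "sigma \<eta> > 0"
    using LIMSEQ_le_const[OF lim(1), of 0] LIMSEQ_le_const[OF lim(2), of 0] \<xi> \<eta>
    by (auto simp: l2_norm_nonneg)
  have "(\<lambda>k. tau (star (P k) * Q k)) \<longlonglongrightarrow> cov \<xi> \<eta>"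
    using tau_inner_L2_class[OF P(1) Q(1)] by (simp add: cov_def P Q)
  then have "(\<lambda>k. cmod (tau (star (P k) * Q k))) \<longlonglongrightarrow> cmod (cov \<xi> \<eta>)"
    by (rule tendsto_norm)
  moreover have "(\<lambda>k. r * (l2_norm (P k) * l2_norm (Q k))) \<longlonglongrightarrow> r * (sigma \<xi> * sigma \<eta>)"
    by (intro tendsto_intros lim)
  ultimately have "cmod (cov \<xi> \<eta>) \<le> r * (sigma \<xi> * sigma \<eta>)"
    using bound P(2) Q(2,3) by (intro LIMSEQ_le) auto
  then have "Re (cov \<xi> \<eta>) \<le> r * (sigma \<xi> * sigma \<eta>)"
    using complex_Re_le_cmod order_trans by blast
  then show ?thesis
    unfolding rho_def using pos by (simp add: pos_divide_le_eq del: of_real_mult)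
qed

end


text \<open>By faithfulness, \<open>nonscalar\<close> makes the common variance of the variables
  positive.\<close>

locale free_id_sequence = tracial_prob_space scale star tau
  for scale :: "complex \<Rightarrow> 'a::ring_1 \<Rightarrow> 'a" (infixr \<open>*\<^sub>C\<close> 75)
    and star :: "'a \<Rightarrow> 'a" and tau :: "'a \<Rightarrow> complex" +
  fixes x :: "nat \<Rightarrow> 'a"
  assumes free: "free_variables x"
    and id_dist: "identically_distributed (x i) (x j)"
    and nonscalar: "x i \<noteq> c *\<^sub>C 1"
begin

subsection \<open>Alternating products of centred elements\<close>

abbreviation centred_at :: "nat \<Rightarrow> 'a \<Rightarrow> bool" where
  "centred_at i a \<equiv> a \<in> star_polys (x i) \<and> tau a = 0"

text \<open>Only the first letter is recorded, since it alone decides the orthogonality of two such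
  products.\<close>

definition alternating :: "nat \<Rightarrow> 'a \<Rightarrow> bool" where
  "alternating k a \<longleftrightarrow> (\<exists>is as. is \<noteq> [] \<and> hd is = k \<and> distinct_adj is \<and>
     list_all2 centred_at is as \<and> prod_list as = a)"

lemma free_tau_prod:
  assumes "list_all2 centred_at is as" "is \<noteq> []" "distinct_adj is"
  shows "tau (prod_list as) = 0"
proof -
  have "length is = length as \<and> (\<forall>j<length as. as ! j \<in> star_polys (x (is ! j)) \<and> tau (as ! j) = 0)"
    using assms(1) by (simp add: list_all2_conv_all_nth)
  moreover from this have "as \<noteq> []" using assms(2) by auto
  ultimately show ?thesis
    using free assms(3) unfolding free_variables_def free_subalgebras_def by blast
qed

lemma alternating_single: "centred_at k a \<Longrightarrow> alternating k a"
  unfolding alternating_def by (rule exI[of _ "[k]"], rule exI[of _ "[a]"]) simp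

lemma alternating_mult:
  assumes "centred_at k a" "alternating l b" "k \<noteq> l"
  shows "alternating k (a * b)"
proof -
  obtain "is" as where "is \<noteq> []" "hd is = l" "distinct_adj is" "list_all2 centred_at is as"
    "prod_list as = b"
    using assms(2) by (auto simp: alternating_def)
  then show ?thesis
    unfolding alternating_def using assms(1,3)
    by (intro exI[of _ "k # is"] exI[of _ "a # as"]) (auto simp: distinct_adj_Cons)
qed

lemma tau_alternating: "alternating k a \<Longrightarrow> tau a = 0"
  by (auto simp: alternating_def intro: free_tau_prod)

text \<open>The adjoint reverses the first word, so \<open>k\<close> and \<open>l\<close> meet at
  the junction. As they differ, the concatenated word still alternates and freeness gives trace
  0.\<close>

lemma alternating_orthogonal:
  assumes "alternating k a" "alternating l b" "k \<noteq> l"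
  shows "tau (star a * b) = 0"
proof -
  obtain "is" as where a: "is \<noteq> []" "hd is = k" "distinct_adj is" "list_all2 centred_at is as"
    "prod_list as = a"
    using assms(1) by (auto simp: alternating_def)
  obtain js bs where b: "js \<noteq> []" "hd js = l" "distinct_adj js" "list_all2 centred_at js bs"
    "prod_list bs = b"
    using assms(2) by (auto simp: alternating_def)
  have "list_all2 centred_at is (map star as)"
    unfolding list_all2_map2 using a(4)
    by (rule list_all2_mono) (auto simp: star_polys_star tau_star)
  then have "list_all2 centred_at (rev is @ js) (rev (map star as) @ bs)"
    using b(4) by (intro list_all2_appendI) simp_all
  moreover have "distinct_adj (rev is @ js)"
    using a b assms(3) by (auto simp: distinct_adj_append_iff last_rev)
  ultimately have "tau (prod_list (rev (map star as) @ bs)) = 0"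
    using b(1) by (intro free_tau_prod) auto
  then show ?thesis by (simp add: star_prod_list a(5)[symmetric] b(5)[symmetric])
qed

subsection \<open>Polynomials with exchangeable variables\<close>

text \<open>
  A formal *-polynomial in the variables indexed by \<open>T\<close> is represented by the function sending
  a relabelling \<open>\<sigma>\<close> to its value at the variables \<open>x (\<sigma> i)\<close>.
\<close>

inductive poly_family :: "nat set \<Rightarrow> ((nat \<Rightarrow> nat) \<Rightarrow> 'a) \<Rightarrow> bool" for T where
  one: "poly_family T (\<lambda>_. 1)"
| var: "i \<in> T \<Longrightarrow> poly_family T F \<Longrightarrow> poly_family T (\<lambda>\<sigma>. x (\<sigma> i) * F \<sigma>)"
| star_var: "i \<in> T \<Longrightarrow> poly_family T F \<Longrightarrow> poly_family T (\<lambda>\<sigma>. star (x (\<sigma> i)) * F \<sigma>)"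
| add: "poly_family T F \<Longrightarrow> poly_family T G \<Longrightarrow> poly_family T (\<lambda>\<sigma>. F \<sigma> + G \<sigma>)"
| scale: "poly_family T F \<Longrightarrow> poly_family T (\<lambda>\<sigma>. c *\<^sub>C F \<sigma>)"

lemma poly_family_mono: "poly_family T F \<Longrightarrow> T \<subseteq> U \<Longrightarrow> poly_family U F"
  by (induction rule: poly_family.induct) (auto intro: poly_family.intros)

lemma poly_family_mult:
  assumes "poly_family T F" "poly_family T G"
  shows "poly_family T (\<lambda>\<sigma>. F \<sigma> * G \<sigma>)"
  using assms
  by (induction rule: poly_family.induct)
     (auto simp: mult.assoc distrib_right scale_mult_left intro: poly_family.intros)

lemma poly_family_x:
  assumes "i \<in> T"
  shows "poly_family T (\<lambda>\<sigma>. x (\<sigma> i))" "poly_family T (\<lambda>\<sigma>. star (x (\<sigma> i)))"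
  using poly_family.var[OF assms poly_family.one] poly_family.star_var[OF assms poly_family.one]
  by simp_all

lemma poly_family_star:
  assumes "poly_family T F"
  shows "poly_family T (\<lambda>\<sigma>. star (F \<sigma>))"
  using assms
  by (induction rule: poly_family.induct)
     (auto simp: star_mult star_one star_add star_scale star_star
       intro: poly_family.intros poly_family_mult poly_family_x)

lemma poly_family_zero: "poly_family T (\<lambda>_. 0)"
  using poly_family.scale[OF poly_family.one, of T 0] by simp

lemma poly_family_sum:
  "(\<And>i. i \<in> A \<Longrightarrow> poly_family T (F i)) \<Longrightarrow> poly_family T (\<lambda>\<sigma>. \<Sum>i\<in>A. F i \<sigma>)"
  by (induction A rule: infinite_finite_induct) (simp_all add: poly_family_zero poly_family.add)

lemma poly_family_sub_const:
  assumes "poly_family T F"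
  shows "poly_family T (\<lambda>\<sigma>. F \<sigma> - c *\<^sub>C 1)"
  using poly_family.add[OF assms poly_family.scale[OF poly_family.one, of T "- c"]] by simp

lemma poly_family_star_polys: "poly_family {i} F \<Longrightarrow> F \<sigma> \<in> star_polys (x (\<sigma> i))"
  by (induction rule: poly_family.induct)
     (auto intro: star_polys_one star_polys_mult star_polys_add star_polys_scale)

text \<open>The additional word makes the claim inductive: it collects the letters stripped off so far.\<close>

lemma tau_word_poly_family_singleton:
  assumes "poly_family {i} F" "set w \<subseteq> {..<2}"
  shows "tau (prod_list (map ((!) [x (\<sigma> i), star (x (\<sigma> i))]) w) * F \<sigma>)
       = tau (prod_list (map ((!) [x (\<sigma>' i), star (x (\<sigma>' i))]) w) * F \<sigma>')"
  using assms
proof (induction arbitrary: w rule: poly_family.induct)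
  case one
  then show ?case by (simp add: identically_distributed_word[OF id_dist])
next
  case (var j F)
  then show ?case using var.IH[of "w @ [0]"] by (simp add: mult.assoc)
next
  case (star_var j F)
  then show ?case using star_var.IH[of "w @ [1]"] by (simp add: mult.assoc)
next
  case (add F G)
  then show ?case by (simp add: distrib_left tau_add)
next
  case (scale F c)
  then show ?case by (simp add: scale_mult_right tau_scale)
qed

lemma tau_poly_family_singleton: "poly_family {i} F \<Longrightarrow> tau (F \<sigma>) = tau (F \<sigma>')"
  using tau_word_poly_family_singleton[of i F "[]"] by simp

text \<open>The family substitutes the relabelled sum into the same polynomial. Agreement with
  \<open>b\<close> is claimed for every relabelling that preserves the sum, so that cyclic shifts
  will fix polynomials in the full sum.\<close>

lemma star_polys_sum_family:
  assumes "b \<in> star_polys (\<Sum>i\<in>T. x i)"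
  obtains F where "poly_family T F"
    "\<And>\<sigma>. (\<Sum>i\<in>T. x (\<sigma> i)) = (\<Sum>i\<in>T. x i) \<Longrightarrow> F \<sigma> = b"
proof -
  let ?P = "\<lambda>b F. poly_family T F \<and>
      (\<forall>\<sigma>. (\<Sum>i\<in>T. x (\<sigma> i)) = (\<Sum>i\<in>T. x i) \<longrightarrow> F \<sigma> = b)"
  have "\<exists>F. ?P b F"
    using assms
  proof (induction rule: star_polys_induct)
    case one
    then show ?case by (intro exI[of _ "\<lambda>_. 1"]) (simp add: poly_family.one)
  next
    case (mult a)
    then obtain F where F: "?P a F" by blast
    then have "poly_family T (\<lambda>\<sigma>. (\<Sum>i\<in>T. x (\<sigma> i)) * F \<sigma>)"
      by (intro poly_family_mult poly_family_sum poly_family_x) auto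
    then show ?case using F by (intro exI[of _ "\<lambda>\<sigma>. (\<Sum>i\<in>T. x (\<sigma> i)) * F \<sigma>"]) simp
  next
    case (star_mult a)
    then obtain F where F: "?P a F" by blast
    then have "poly_family T (\<lambda>\<sigma>. star (\<Sum>i\<in>T. x (\<sigma> i)) * F \<sigma>)"
      by (intro poly_family_mult poly_family_star poly_family_sum poly_family_x) auto
    then show ?case using F by (intro exI[of _ "\<lambda>\<sigma>. star (\<Sum>i\<in>T. x (\<sigma> i)) * F \<sigma>"]) simp
  next
    case (add a b)
    then obtain F G where "?P a F" "?P b G" by blast
    then show ?case
      by (intro exI[of _ "\<lambda>\<sigma>. F \<sigma> + G \<sigma>"]) (simp add: poly_family.add)
  next
    case (scale c a)
    then obtain F where "?P a F" by blast
    then show ?case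
      by (intro exI[of _ "\<lambda>\<sigma>. c *\<^sub>C F \<sigma>"]) (simp add: poly_family.scale)
  qed
  then show ?thesis using that by blast
qed

subsection \<open>Decomposition by the first letter\<close>

text \<open>The formal counterpart of \<open>alternating\<close>: the letters are those before
  relabelling, while each factor is centred under every relabelling.\<close>

inductive alt_family :: "nat set \<Rightarrow> nat \<Rightarrow> ((nat \<Rightarrow> nat) \<Rightarrow> 'a) \<Rightarrow> bool" for T where
  single: "i \<in> T \<Longrightarrow> poly_family {i} F \<Longrightarrow> (\<And>\<sigma>. tau (F \<sigma>) = 0) \<Longrightarrow> alt_family T i F"
| cons: "i \<in> T \<Longrightarrow> poly_family {i} F \<Longrightarrow> (\<And>\<sigma>. tau (F \<sigma>) = 0) \<Longrightarrow> alt_family T k G \<Longrightarrow> i \<noteq> k \<Longrightarrow>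
    alt_family T i (\<lambda>\<sigma>. F \<sigma> * G \<sigma>)"

inductive alt_span :: "nat set \<Rightarrow> nat \<Rightarrow> ((nat \<Rightarrow> nat) \<Rightarrow> 'a) \<Rightarrow> bool" for T i where
  zero: "alt_span T i (\<lambda>_. 0)"
| add: "alt_family T i F \<Longrightarrow> alt_span T i G \<Longrightarrow> alt_span T i (\<lambda>\<sigma>. F \<sigma> + G \<sigma>)"

text \<open>The scalar and the parts are chosen before \<sigma>, so relabelling a decomposition
  gives the decomposition of the relabelled element.\<close>

definition decomposes :: "nat set \<Rightarrow> ((nat \<Rightarrow> nat) \<Rightarrow> 'a) \<Rightarrow> bool" where
  "decomposes T F \<longleftrightarrow> (\<exists>c W. (\<forall>i\<in>T. alt_span T i (W i)) \<and>
     (\<forall>\<sigma>. F \<sigma> = c *\<^sub>C 1 + (\<Sum>i\<in>T. W i \<sigma>)))"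

lemma alt_family_head: "alt_family T i F \<Longrightarrow> i \<in> T"
  by (auto elim: alt_family.cases)

text \<open>Injectivity keeps neighbouring letters distinct after relabelling.\<close>

lemma alternating_alt_family:
  assumes "alt_family T i F" "inj_on \<sigma> T"
  shows "alternating (\<sigma> i) (F \<sigma>)"
  using assms
proof (induction rule: alt_family.induct)
  case (single i F)
  then show ?case by (intro alternating_single) (auto simp: poly_family_star_polys)
next
  case (cons i F k G)
  then have "\<sigma> i \<noteq> \<sigma> k" by (auto dest: alt_family_head inj_onD)
  with cons show ?case by (intro alternating_mult) (auto simp: poly_family_star_polys)
qed

text \<open>Two relabellings are allowed because parts of different shifts of the same element have
  to be compared.\<close>

lemma alt_span_orthogonal:
  assumes "alt_span T i F" "inj_on \<sigma> T" "alt_span U k G" "inj_on \<sigma>' U" "\<sigma> i \<noteq> \<sigma>' k"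
  shows "tau (star (F \<sigma>) * G \<sigma>') = 0"
  using assms(1)
proof (induction rule: alt_span.induct)
  case zero
  show ?case by (simp add: star_zero tau_zero)
next
  case (add F F')
  have "tau (star (F \<sigma>) * G \<sigma>') = 0"
    using assms(3)
  proof (induction rule: alt_span.induct)
    case (add G G')
    then show ?case
      using alternating_orthogonal[OF
          alternating_alt_family[OF \<open>alt_family T i F\<close> assms(2)]
          alternating_alt_family[OF add.hyps(1) assms(4)] assms(5)]
      by (simp add: distrib_left tau_add)
  qed (simp add: tau_zero)
  with add show ?case by (simp add: star_add distrib_right tau_add)
qed

lemma tau_alt_span:
  assumes "alt_span T i F" "inj_on \<sigma> T"
  shows "tau (F \<sigma>) = 0"
  using assms
proof (induction rule: alt_span.induct)
  case (add F G)
  then show ?case using tau_alternating[OF alternating_alt_family[OF add.hyps(1)]]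
    by (simp add: tau_add)
qed (simp add: tau_zero)

text \<open>The scalar is absorbed into the first factor, which is why \<open>alt_span\<close> can
  be generated by sums alone.\<close>

lemma alt_family_scale:
  assumes "alt_family T i F"
  shows "alt_family T i (\<lambda>\<sigma>. c *\<^sub>C F \<sigma>)"
  using assms
proof cases
  case single
  then show ?thesis by (auto intro: alt_family.single poly_family.scale simp: tau_scale)
next
  case (cons A k G)
  then have "alt_family T i (\<lambda>\<sigma>. (c *\<^sub>C A \<sigma>) * G \<sigma>)"
    by (intro alt_family.cons) (auto intro: poly_family.scale simp: tau_scale)
  then show ?thesis by (simp add: cons scale_mult_left)
qed

lemma alt_span_scale: "alt_span T i F \<Longrightarrow> alt_span T i (\<lambda>\<sigma>. c *\<^sub>C F \<sigma>)"
  by (induction rule: alt_span.induct)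
     (simp_all add: scale_right_distrib alt_span.zero alt_span.add alt_family_scale)

lemma alt_span_add: "alt_span T i F \<Longrightarrow> alt_span T i G \<Longrightarrow> alt_span T i (\<lambda>\<sigma>. F \<sigma> + G \<sigma>)"
  by (induction rule: alt_span.induct) (simp_all add: add.assoc alt_span.add)

lemma alt_span_base: "alt_family T i F \<Longrightarrow> alt_span T i F"
  using alt_span.add[OF _ alt_span.zero] by fastforce

lemma decomposes_const: "decomposes T (\<lambda>_. c *\<^sub>C 1)"
  unfolding decomposes_def
  by (rule exI[of _ c], rule exI[of _ "\<lambda>_ _. 0"]) (simp add: alt_span.zero)

lemma decomposes_add:
  assumes "decomposes T F" "decomposes T G"
  shows "decomposes T (\<lambda>\<sigma>. F \<sigma> + G \<sigma>)"
proof -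
  obtain c W where 1: "\<forall>i\<in>T. alt_span T i (W i)" "\<And>\<sigma>. F \<sigma> = c *\<^sub>C 1 + (\<Sum>i\<in>T. W i \<sigma>)"
    using assms(1) by (auto simp: decomposes_def)
  obtain d V where 2: "\<forall>i\<in>T. alt_span T i (V i)" "\<And>\<sigma>. G \<sigma> = d *\<^sub>C 1 + (\<Sum>i\<in>T. V i \<sigma>)"
    using assms(2) by (auto simp: decomposes_def)
  show ?thesis
    unfolding decomposes_def using 1 2
    by (intro exI[of _ "c + d"] exI[of _ "\<lambda>i \<sigma>. W i \<sigma> + V i \<sigma>"])
       (auto simp: sum.distrib scale_left_distrib intro: alt_span_add)
qed

lemma decomposes_scale:
  assumes "decomposes T F"
  shows "decomposes T (\<lambda>\<sigma>. c *\<^sub>C F \<sigma>)"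
proof -
  obtain d W where 1: "\<forall>i\<in>T. alt_span T i (W i)" "\<And>\<sigma>. F \<sigma> = d *\<^sub>C 1 + (\<Sum>i\<in>T. W i \<sigma>)"
    using assms(1) by (auto simp: decomposes_def)
  show ?thesis
    unfolding decomposes_def using 1
    by (intro exI[of _ "c * d"] exI[of _ "\<lambda>i \<sigma>. c *\<^sub>C W i \<sigma>"])
       (auto simp: scale_right_distrib scale_sum_right intro: alt_span_scale)
qed

lemma decomposes_sum:
  "(\<And>i. i \<in> A \<Longrightarrow> decomposes T (F i)) \<Longrightarrow> decomposes T (\<lambda>\<sigma>. \<Sum>i\<in>A. F i \<sigma>)"
  using decomposes_const[of T 0]
  by (induction A rule: infinite_finite_induct) (simp_all add: decomposes_add)

lemma decomposes_alt_family:
  assumes "alt_family T i F" "finite T"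
  shows "decomposes T F"
proof -
  define W where "W j = (if j = i then F else (\<lambda>_. 0))" for j
  have "alt_span T j (W j)" for j
    using alt_span_base[OF assms(1)] by (simp add: W_def alt_span.zero)
  moreover have "(\<Sum>j\<in>T. W j \<sigma>) = F \<sigma>" for \<sigma>
    using assms(2) alt_family_head[OF assms(1)]
    by (subst sum.remove[of _ i]) (auto simp: W_def intro: sum.neutral)
  ultimately show ?thesis
    unfolding decomposes_def by (intro exI[of _ 0] exI[of _ W]) simp
qed

text \<open>One scalar centres all relabellings at once, because the variables are identically
  distributed.\<close>

lemma centre_poly_family_singleton:
  assumes "poly_family {k} A"
  obtains c where "poly_family {k} (\<lambda>\<sigma>. A \<sigma> - c *\<^sub>C 1)" "\<And>\<sigma>. tau (A \<sigma> - c *\<^sub>C 1) = 0"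
  using that[of "tau (A id)"] poly_family_sub_const[OF assms] tau_poly_family_singleton[OF assms, of _ id]
  by (simp add: tau_diff tau_scale tau_one)

lemma decomposes_poly_family_singleton:
  assumes "poly_family {k} A" "k \<in> T" "finite T"
  shows "decomposes T A"
proof -
  obtain c where "poly_family {k} (\<lambda>\<sigma>. A \<sigma> - c *\<^sub>C 1)" "\<And>\<sigma>. tau (A \<sigma> - c *\<^sub>C 1) = 0"
    using assms(1) by (rule centre_poly_family_singleton) blast
  then have "decomposes T (\<lambda>\<sigma>. A \<sigma> - c *\<^sub>C 1)"
    using assms(2,3) by (intro decomposes_alt_family[of T k] alt_family.single) auto
  from decomposes_add[OF this decomposes_const[of T c]] show ?thesis by simp
qed

text \<open>Writing \<open>A\<close> as its centred part plus a scalar, the first term lengthens the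
  alternating product and the second gives a multiple of \<open>G\<close>.\<close>

lemma decomposes_mult_alt_family_neq:
  assumes "poly_family {k} A" "k \<in> T" "finite T" "alt_family T i G" "k \<noteq> i"
  shows "decomposes T (\<lambda>\<sigma>. A \<sigma> * G \<sigma>)"
proof -
  obtain c where "poly_family {k} (\<lambda>\<sigma>. A \<sigma> - c *\<^sub>C 1)" "\<And>\<sigma>. tau (A \<sigma> - c *\<^sub>C 1) = 0"
    using assms(1) by (rule centre_poly_family_singleton) blast
  then have 1: "decomposes T (\<lambda>\<sigma>. (A \<sigma> - c *\<^sub>C 1) * G \<sigma>)"
    using assms(2-5) by (intro decomposes_alt_family[of T k] alt_family.cons[of k T _ i]) auto
  have 2: "decomposes T (\<lambda>\<sigma>. c *\<^sub>C G \<sigma>)"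
    using decomposes_scale[OF decomposes_alt_family[OF assms(4,3)]] .
  from decomposes_add[OF 1 2] show ?thesis
    by (simp add: left_diff_distrib scale_mult_left)
qed

text \<open>If \<open>A\<close> uses the first letter of \<open>G\<close>, it merges with the first
  factor into a polynomial in the same variable. What follows starts with a different letter, so the
  previous case applies.\<close>

lemma decomposes_mult_alt_family:
  assumes A: "poly_family {k} A" "k \<in> T" "finite T" and G: "alt_family T i G"
  shows "decomposes T (\<lambda>\<sigma>. A \<sigma> * G \<sigma>)"
proof (cases "k = i")
  case True
  from G show ?thesis
  proof cases
    case single
    then show ?thesis
      using A True by (intro decomposes_poly_family_singleton poly_family_mult) auto
  next
    case (cons F l H)
    then have "decomposes T (\<lambda>\<sigma>. (A \<sigma> * F \<sigma>) * H \<sigma>)"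
      using A True by (intro decomposes_mult_alt_family_neq[where k = k] poly_family_mult) auto
    then show ?thesis by (simp add: cons mult.assoc)
  qed
qed (use assms in \<open>auto intro: decomposes_mult_alt_family_neq\<close>)

lemma decomposes_mult:
  assumes A: "poly_family {k} A" "k \<in> T" "finite T" and F: "decomposes T F"
  shows "decomposes T (\<lambda>\<sigma>. A \<sigma> * F \<sigma>)"
proof -
  obtain c W where W: "\<And>i. i \<in> T \<Longrightarrow> alt_span T i (W i)"
    "\<And>\<sigma>. F \<sigma> = c *\<^sub>C 1 + (\<Sum>i\<in>T. W i \<sigma>)"
    using F by (auto simp: decomposes_def)
  have "decomposes T (\<lambda>\<sigma>. A \<sigma> * V \<sigma>)" if "alt_span T i V" for i V
    using that
  proof (induction rule: alt_span.induct)
    case zero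
    then show ?case using decomposes_const[of T 0] by simp
  next
    case (add F G)
    then show ?case
      using decomposes_add[OF decomposes_mult_alt_family[OF A]] by (simp add: distrib_left)
  qed
  then have "decomposes T (\<lambda>\<sigma>. c *\<^sub>C A \<sigma> + (\<Sum>i\<in>T. A \<sigma> * W i \<sigma>))"
    using W(1) decomposes_poly_family_singleton[OF A]
    by (intro decomposes_add[OF decomposes_scale decomposes_sum]) auto
  then show ?thesis
    by (simp add: W(2) distrib_left sum_distrib_left scale_mult_right)
qed

lemma decomposes_poly_family:
  assumes "poly_family T F" "finite T"
  shows "decomposes T F"
  using assms
proof (induction rule: poly_family.induct)
  case one
  then show ?case using decomposes_const[of T 1] by simp
next
  case (var i F)
  then show ?case using decomposes_mult[OF poly_family_x(1)[of i "{i}"]] by simp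
next
  case (star_var i F)
  then show ?case using decomposes_mult[OF poly_family_x(2)[of i "{i}"]] by simp
qed (auto intro: decomposes_add decomposes_scale)

lemma poly_family_decomposition:
  assumes "poly_family T F" "finite T"
  obtains c W where "\<And>i. i \<in> T \<Longrightarrow> alt_span T i (W i)"
    "\<And>\<sigma>. F \<sigma> = c *\<^sub>C 1 + (\<Sum>i\<in>T. W i \<sigma>)" "\<And>\<sigma>. inj_on \<sigma> T \<Longrightarrow> tau (F \<sigma>) = c"
proof -
  obtain c W where W: "\<And>i. i \<in> T \<Longrightarrow> alt_span T i (W i)"
    "\<And>\<sigma>. F \<sigma> = c *\<^sub>C 1 + (\<Sum>i\<in>T. W i \<sigma>)"
    using decomposes_poly_family[OF assms] by (auto simp: decomposes_def)
  have "tau (F \<sigma>) = c" if "inj_on \<sigma> T" for \<sigma>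
  proof -
    have "(\<Sum>i\<in>T. tau (W i \<sigma>)) = 0"
      using tau_alt_span[OF W(1) that] by (intro sum.neutral) auto
    then show ?thesis by (simp add: W(2) tau_add tau_scale tau_one tau_sum)
  qed
  with W that show ?thesis by blast
qed

text \<open>By freeness every alternating part has trace 0 under an injective relabelling, so both
  traces equal the scalar term of the decomposition.\<close>

lemma tau_poly_family_exchangeable:
  assumes "poly_family T F" "finite T" "inj_on \<sigma> T" "inj_on \<sigma>' T"
  shows "tau (F \<sigma>) = tau (F \<sigma>')"
  using poly_family_decomposition[OF assms(1,2)] assms(3,4) by metis

subsection \<open>The correlation bound\<close>

lemma l2_norm_average_le:
  assumes G: "poly_family {..<m} G" "\<And>\<sigma>. inj_on \<sigma> {..<m} \<Longrightarrow> tau (G \<sigma>) = 0"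
    and inj: "\<And>j. j \<in> J \<Longrightarrow> inj_on (s j) {..<m}"
    and inj': "\<And>i. i < m \<Longrightarrow> inj_on (\<lambda>j. s j i) J"
  shows "(l2_norm (\<Sum>j\<in>J. G (s j)))\<^sup>2 \<le> m * (\<Sum>j\<in>J. (l2_norm (G (s j)))\<^sup>2)"
proof -
  obtain c W where W: "\<And>i. i \<in> {..<m} \<Longrightarrow> alt_span {..<m} i (W i)"
    "\<And>\<sigma>. G \<sigma> = c *\<^sub>C 1 + (\<Sum>i<m. W i \<sigma>)"
    "\<And>\<sigma>. inj_on \<sigma> {..<m} \<Longrightarrow> tau (G \<sigma>) = c"
    using G(1) finite_lessThan by (rule poly_family_decomposition) blast
  have "c = 0" using W(3)[of id] G(2)[of id] by simp
  then have sum: "G \<sigma> = (\<Sum>i<m. W i \<sigma>)" for \<sigma> by (simp add: W(2))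
  have "(l2_norm (\<Sum>j\<in>J. G (s j)))\<^sup>2 = (l2_norm (\<Sum>i<m. \<Sum>j\<in>J. W i (s j)))\<^sup>2"
    by (simp only: sum sum.swap[of _ J])
  also have "\<dots> \<le> m * (\<Sum>i<m. (l2_norm (\<Sum>j\<in>J. W i (s j)))\<^sup>2)"
    using l2_norm_sum_squared_le[of _ "{..<m}"] by simp
  also have "(\<Sum>i<m. (l2_norm (\<Sum>j\<in>J. W i (s j)))\<^sup>2) = (\<Sum>i<m. \<Sum>j\<in>J. (l2_norm (W i (s j)))\<^sup>2)"
  proof (intro sum.cong refl l2_norm_pythagoras)
    \<comment> \<open>For fixed \<open>i\<close>, distinct shifts send \<open>i\<close> to distinct
      first letters.\<close>
    fix i j k assume "i \<in> {..<m}" "j \<in> J" "k \<in> J" "j \<noteq> k"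
    then show "tau (star (W i (s j)) * W i (s k)) = 0"
      using inj_onD[OF inj'[of i], of j k]
      by (intro alt_span_orthogonal[OF W(1) inj W(1) inj]) auto
  qed
  also have "\<dots> = (\<Sum>j\<in>J. \<Sum>i<m. (l2_norm (W i (s j)))\<^sup>2)"
    by (rule sum.swap)
  also have "\<dots> = (\<Sum>j\<in>J. (l2_norm (G (s j)))\<^sup>2)"
    unfolding sum
  proof (intro sum.cong refl l2_norm_pythagoras[symmetric])
    \<comment> \<open>Within one shift, injectivity of \<open>s j\<close> keeps the first letters
      apart.\<close>
    fix j i k assume "j \<in> J" "i \<in> {..<m}" "k \<in> {..<m}" "i \<noteq> k"
    then show "tau (star (W i (s j)) * W k (s j)) = 0"
      using inj_onD[OF inj[of j], of i k]
      by (intro alt_span_orthogonal[OF W(1) inj W(1) inj]) auto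
  qed
  finally show ?thesis .
qed

lemma correlation_bound:
  assumes a: "a \<in> star_polys (\<Sum>i<n. x i)" and b: "b \<in> star_polys (\<Sum>i<m. x i)" "tau b = 0"
    and m: "1 \<le> m" "m \<le> n"
  shows "cmod (tau (star a * b)) \<le> sqrt (m / n) * (l2_norm a * l2_norm b)"
proof -
  obtain F where F: "poly_family {..<n} F" "\<And>\<sigma>. (\<Sum>i<n. x (\<sigma> i)) = (\<Sum>i<n. x i) \<Longrightarrow> F \<sigma> = a"
    using a by (rule star_polys_sum_family) blast
  obtain G where G: "poly_family {..<m} G" "\<And>\<sigma>. (\<Sum>i<m. x (\<sigma> i)) = (\<Sum>i<m. x i) \<Longrightarrow> G \<sigma> = b"
    using b(1) by (rule star_polys_sum_family) blast
  \<comment> \<open>The shift \<open>(i + j) mod n\<close> for \<open>i, j < n\<close>, written as a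
    case distinction so that injectivity in either argument is linear arithmetic.\<close>
  define s where "s j i = (if i + j < n then i + j else i + j - n)" for j i
  have inj: "inj_on (s j) {..<n}" if "j < n" for j
    using that by (auto simp: inj_on_def s_def split: if_splits)
  have inj': "inj_on (\<lambda>j. s j i) {..<n}" if "i < n" for i
    using that by (auto simp: inj_on_def s_def split: if_splits)
  have inj_m: "inj_on (s j) {..<m}" if "j < n" for j
    using inj[of j] that m by (auto elim: inj_on_subset)
  have "s j ` {..<n} = {..<n}" if "j < n" for j
    using inj[of j] that m by (intro endo_inj_surj) (auto simp: s_def)
  then have "(\<Sum>i<n. x (s j i)) = (\<Sum>i<n. x i)" if "j < n" for j
    using sum.reindex[OF inj, of j x] that by simp
  then have Fs: "F (s j) = a" if "j < n" for j using F(2) that by blast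
  have Gid: "G id = b" and Fid: "F id = a" using F(2) G(2) by simp_all
  \<comment> \<open>Viewing \<open>G\<close> over all \<open>n\<close> letters puts the joint moment
    of \<open>a\<close> and \<open>b\<close> under a single exchangeability statement; the shifts
    fix \<open>a\<close> and move only \<open>b\<close>.\<close>
  have "poly_family {..<n} (\<lambda>\<sigma>. star (F \<sigma>) * G \<sigma>)"
    using F(1) G(1) m(2)
    by (intro poly_family_mult poly_family_star) (auto intro: poly_family_mono)
  from tau_poly_family_exchangeable[OF this finite_lessThan inj inj_on_id]
  have inner: "tau (star a * G (s j)) = tau (star a * b)" if "j < n" for j
    using that by (metis Fs Fid Gid)
  have "poly_family {..<m} (\<lambda>\<sigma>. star (G \<sigma>) * G \<sigma>)"
    by (intro poly_family_mult poly_family_star G)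
  from tau_poly_family_exchangeable[OF this finite_lessThan inj_m inj_on_id]
  have norm: "l2_norm (G (s j)) = l2_norm b" if "j < n" for j
    using that by (intro l2_norm_eqI) (simp add: Gid)
  have centred: "tau (G \<sigma>) = 0" if "inj_on \<sigma> {..<m}" for \<sigma>
    using tau_poly_family_exchangeable[OF G(1) finite_lessThan that inj_on_id] b(2) by (simp add: Gid)
  have "(l2_norm (\<Sum>j<n. G (s j)))\<^sup>2 \<le> m * (\<Sum>j<n. (l2_norm (G (s j)))\<^sup>2)"
    using inj_m inj' m by (intro l2_norm_average_le[OF G(1) centred]) auto
  also have "\<dots> = real m * real n * (l2_norm b)\<^sup>2" by (simp add: norm)
  finally have "l2_norm (\<Sum>j<n. G (s j)) \<le> sqrt (real m * real n * (l2_norm b)\<^sup>2)"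
    by (rule real_le_rsqrt)
  then have le: "l2_norm (\<Sum>j<n. G (s j)) \<le> sqrt (real m * real n) * l2_norm b"
    by (simp add: real_sqrt_mult l2_norm_nonneg)
  have "real n * cmod (tau (star a * b)) = cmod (\<Sum>j<n. tau (star a * G (s j)))"
    by (simp add: inner norm_mult)
  also have "\<dots> = cmod (tau (star a * (\<Sum>j<n. G (s j))))"
    by (simp add: sum_distrib_left tau_sum)
  also have "\<dots> \<le> l2_norm a * (sqrt (real m * real n) * l2_norm b)"
    using l2_Cauchy_Schwarz mult_left_mono[OF le l2_norm_nonneg] by (rule order_trans)
  also have "sqrt (real m * real n) = real n * sqrt (m / n)"
    using m by (simp add: real_sqrt_mult real_sqrt_divide real_div_sqrt field_simps)
  finally have "real n * cmod (tau (star a * b)) \<le> real n * (sqrt (m / n) * (l2_norm a * l2_norm b))"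
    by (simp add: mult_ac)
  then show ?thesis using m by (subst (asm) mult_le_cancel_left_pos) auto
qed

text \<open>The centred variables are pairwise orthogonal by freeness and share one variance, so
  only the \<open>k\<close> common indices contribute.\<close>

lemma tau_centred_sums:
  assumes "k \<le> l"
  shows "tau (star ((\<Sum>i<l. x i) - tau (\<Sum>i<l. x i) *\<^sub>C 1) * ((\<Sum>i<k. x i) - tau (\<Sum>i<k. x i) *\<^sub>C 1))
    = of_nat k * of_real ((l2_norm (x 0 - tau (x 0) *\<^sub>C 1))\<^sup>2)"
proof -
  define y where "y i = x i - tau (x i) *\<^sub>C 1" for i
  have y: "(\<Sum>i<k. x i) - tau (\<Sum>i<k. x i) *\<^sub>C 1 = (\<Sum>i<k. y i)" for k
    by (simp add: y_def sum_subtractf tau_sum scale_sum_left)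
  have alt: "alternating i (y i)" for i
    by (rule alternating_single)
       (auto simp: y_def tau_diff tau_scale tau_one
         intro: star_polys_diff star_polys_self star_polys_scale star_polys_one)
  have "tau (star (y i) * y i) = tau (star (y 0) * y 0)" for i
    using identically_distributed_moments[OF id_dist, of i 0]
    by (simp add: y_def star_diff star_scale star_one algebra_simps tau_diff tau_add tau_scale
        scale_mult_left scale_mult_right tau_star)
  then have "tau (star (y i) * y j) = (if i = j then of_real ((l2_norm (y 0))\<^sup>2) else 0)" for i j
    using alternating_orthogonal[OF alt alt, of i j] by (simp add: tau_square[of "y 0"])
  then have "tau (star (\<Sum>i<l. y i) * (\<Sum>j<k. y j))
      = (\<Sum>i<l. \<Sum>j<k. if i = j then of_real ((l2_norm (y 0))\<^sup>2) else 0)"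
    by (simp add: star_sum sum_product tau_sum)
  \<comment> \<open>With the longer range inside, each inner sum meets its diagonal term exactly
    once.\<close>
  also have "\<dots> = (\<Sum>j<k. \<Sum>i<l. if i = j then of_real ((l2_norm (y 0))\<^sup>2) else 0)"
    by (rule sum.swap)
  also have "\<dots> = (\<Sum>j<k. of_real ((l2_norm (y 0))\<^sup>2))"
    using assms by (intro sum.cong refl) simp
  finally show ?thesis by (simp add: y) (simp add: y_def)
qed

lemma max_corr_sums:
  assumes m: "1 \<le> m" "m \<le> n"
  shows "max_corr (\<Sum>i<n. x i) (\<Sum>i<m. x i) = sqrt (m / n)"
proof -
  define v where "v = l2_norm (x 0 - tau (x 0) *\<^sub>C 1)"
  have v: "v > 0"
    using l2_norm_eq_0[of "x 0 - tau (x 0) *\<^sub>C 1"] l2_norm_nonneg[of "x 0 - tau (x 0) *\<^sub>C 1"]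
      nonscalar[of 0 "tau (x 0)"] by (auto simp: v_def)
  let ?s = "\<lambda>k. L2_emb (\<Sum>i<k. x i)"
  have sigma: "sigma (?s k) = sqrt k * v" for k
  proof -
    have "Re (cov (?s k) (?s k)) = Re (complex_of_real (real k * v\<^sup>2))"
      using tau_centred_sums[of k k, folded v_def] by (simp add: cov_emb)
    then show ?thesis
      using v by (simp only: sigma_def Re_complex_of_real real_sqrt_mult real_sqrt_abs abs_of_pos)
  qed
  have cov: "cov (?s n) (?s m) = complex_of_real (real m * v\<^sup>2)"
    using tau_centred_sums[OF m(2), folded v_def] by (simp add: cov_emb)
  have "rho (?s n) (?s m) = complex_of_real (real m * v\<^sup>2 / (sqrt n * v * (sqrt m * v)))"
    by (simp add: rho_def cov sigma)
  then have "Re (rho (?s n) (?s m)) = real m * v\<^sup>2 / (sqrt n * v * (sqrt m * v))" by simp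
  also have "\<dots> = real m / (sqrt n * sqrt m)"
    using v by (simp add: power2_eq_square)
  also have "\<dots> = sqrt (m / n)"
    using m by (simp add: real_sqrt_divide field_simps)
  finally have rho: "Re (rho (?s n) (?s m)) = sqrt (m / n)" .
  \<comment> \<open>The value is attained at the pair of sums themselves, and
    \<open>correlation_bound\<close> makes it an upper bound.\<close>
  show ?thesis
    unfolding max_corr_def max_corr_subspaces_def
  proof (rule cSup_eq_maximum)
    have "sigma (?s n) \<noteq> 0" "sigma (?s m) \<noteq> 0" using v m by (auto simp: sigma)
    then show "sqrt (m / n) \<in> {Re (rho \<xi> \<eta>) | \<xi> \<eta>. \<xi> \<in> L2_of (\<Sum>i<n. x i) \<and>
        \<eta> \<in> L2_of (\<Sum>i<m. x i) \<and> sigma \<xi> \<noteq> 0 \<and> sigma \<eta> \<noteq> 0}"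
      using rho L2_emb_in_L2_of[OF star_polys_self] by force
  qed (use correlation_bound[OF _ _ _ m] in \<open>auto intro: Re_rho_le\<close>)
qed

end

text \<open>Indices start at 0, so the sum over \<open>i < n\<close> has \<open>n\<close> terms.
  Being non-zero is expressed as being no scalar multiple of 1: for scalar variables every \<sigma>
  vanishes and no pair enters the supremum. The condition \<open>1 \<le> m\<close> likewise excludes
  the empty sum.\<close>

theorem theorem1p1:
  fixes scale :: "complex \<Rightarrow> 'a::ring_1 \<Rightarrow> 'a"
    and star :: "'a \<Rightarrow> 'a"
    and tau :: "'a \<Rightarrow> complex"
    and x :: "nat \<Rightarrow> 'a"
    and m n :: nat
  assumes "tracial_prob_space scale star tau"
    and "tracial_prob_space.free_variables scale star tau x"
    and "\<And>i j. tracial_prob_space.identically_distributed star tau (x i) (x j)"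
    and "\<And>i c. x i \<noteq> scale c 1"
    and "1 \<le> m" and "m \<le> n"
  shows "tracial_prob_space.max_corr scale star tau (\<Sum>i<n. x i) (\<Sum>i<m. x i) = sqrt (real m / real n)"
proof -
  interpret free_id_sequence scale star tau x
    using assms(1-4) by (intro free_id_sequence.intro free_id_sequence_axioms.intro)
  show ?thesis using assms(5,6) by (rule max_corr_sums)
qed

end
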